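(* Let $c<0$ and $\kappa>0$. If $$e^{-c/(4\kappa)}\left[\frac{-c}{2\kappa}+(2-\cos\alpha-\beta)\left(1-e^{c/(4\kappa)}\right)\right]\le \cos\alpha-\beta,$$ then the function $z\mapsto z\,u_p(z)$ belongs to the class $\mathcal{SP}_p(\alpha,\beta)$.
   Context: Throughout, $\alpha,\beta$ are real with $|\alpha|<\pi/2$ and $0\le\beta<1$. Let $\mathbb{U}=\{z\in\mathbb{C}:|z|<1\}$ and let $\mathcal{A}$ be the class of functions analytic in $\mathbb{U}$ of the form $f(z)=z+\sum_{n=2}^{\infty}a_nz^n$. A function $f\in\mathcal{A}$ belongs to $\mathcal{SP}_p(\alpha,\beta)$ if $\operatorname{Re}\left\{e^{-i\alpha}\frac{zf'(z)}{f(z)}\right\}>\left|\frac{zf'(z)}{f(z)}-1\right|+\beta$ for all $z\in\mathbb{U}$ (the quotient being read as its limit $1$ at $z=0$); the subscript $p$ in the name $\mathcal{SP}_p$ is only part of the notation. The generalized normalized Bessel function with parameters $p,b,c$ is the entire function $u_p(z)=\sum_{n=0}^{\infty}\frac{(-c/4)^n}{(\kappa)_n\,n!}z^n$, where $\kappa=p+(b+1)/2\ne 0,-1,-2,\ldots$ and $(a)_0=1$, $(a)_n=a(a+1)\cdots(a+n-1)$ for $n\ge1$. *)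

theory Defs
  imports "HOL-Complex_Analysis.Complex_Analysis"
begin

abbreviation unit_disc :: "complex set" where
  "unit_disc \<equiv> ball 0 1"

text \<open>Only the values on the unit disc matter; the representing functions are total.\<close>

definition class_A :: "(complex \<Rightarrow> complex) set" where
  "class_A = {f. f analytic_on unit_disc \<and>
     (\<exists>a :: nat \<Rightarrow> complex. \<forall>z\<in>unit_disc. (\<lambda>n. a (n + 2) * z ^ (n + 2)) sums (f z - z))}"

definition log_deriv_quotient :: "(complex \<Rightarrow> complex) \<Rightarrow> complex \<Rightarrow> complex" where
  "log_deriv_quotient f z = (if z = 0 then 1 else z * deriv f z / f z)"

text \<open>At a zero of \<open>f\<close> other than the origin the quotient has a pole, so \<open>f\<close> should not
  belong to the class. Division by zero gives the quotient the value \<open>0\<close> there, and the inequality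
  below then reads \<open>0 > 1 + \<beta>\<close>, which indeed fails for \<open>\<beta> \<ge> 0\<close>.\<close>

definition class_SP :: "real \<Rightarrow> real \<Rightarrow> (complex \<Rightarrow> complex) set" where
  "class_SP \<alpha> \<beta> = {f \<in> class_A. \<forall>z\<in>unit_disc.
     Re (exp (- \<i> * of_real \<alpha>) * log_deriv_quotient f z)
       > cmod (log_deriv_quotient f z - 1) + \<beta>}"

definition bessel_kappa :: "complex \<Rightarrow> complex \<Rightarrow> complex" where
  "bessel_kappa p b = p + (b + 1) / 2"

definition bessel_u :: "complex \<Rightarrow> complex \<Rightarrow> complex \<Rightarrow> complex \<Rightarrow> complex" where
  "bessel_u p b c z =
     (\<Sum>n. (- c / 4) ^ n / (pochhammer (bessel_kappa p b) n * fact n) * z ^ n)"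

end

theory Submission
  imports Defs
begin

text \<open>Put \<open>f z = z * u z\<close> with \<open>u = u\<^sub>p\<close>, and \<open>t = - c / (4 * \<kappa>)\<close>. Everything rests on
  one comparison: since \<open>\<kappa>\<^sup>n\<close> is at most the Pochhammer symbol \<open>(\<kappa>)\<^sub>n\<close>, the \<open>n\<close>-th coefficient
  of \<open>u\<close> has modulus at most \<open>t\<^sup>n / n!\<close>, so \<open>u\<close> is dominated term by term by \<open>exp (t * z)\<close>
  (\<open>norm_bessel_coeff_le\<close>). With \<open>s = t * \<bar>z\<bar>\<close> this gives \<open>\<bar>u z - 1\<bar> \<le> exp s - 1\<close> and
  \<open>\<bar>z * u' z\<bar> \<le> s * exp s\<close>.

  The logarithmic derivative quotient of \<open>f\<close> is \<open>q = 1 + z * u' z / u z\<close>. Because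
  \<open>Re (e\<^sup>-\<^sup>i\<^sup>\<alpha> q)\<close> differs from \<open>cos \<alpha>\<close> by at most \<open>\<bar>q - 1\<bar>\<close>, membership in the class follows
  from \<open>2 * \<bar>q - 1\<bar> < d\<close>, where \<open>d = cos \<alpha> - \<beta>\<close> (\<open>spirallike_inequalityI\<close>). By the two bounds
  this holds as soon as \<open>2 * s * exp s < d * (2 - exp s)\<close>. The hypothesis, multiplied out, reads
  \<open>2 * t * exp t + (2 - cos \<alpha> - \<beta>) * (exp t - 1) \<le> d\<close>. It implies \<open>d > 0\<close>, and with
  \<open>d \<le> 2 - cos \<alpha> - \<beta>\<close> it gives \<open>2 * t * exp t \<le> d * (2 - exp t)\<close>. Strictness comes from
  \<open>s < t\<close>, which is where \<open>\<bar>z\<bar> < 1\<close> enters.\<close>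

lemma power_le_pochhammer:
  fixes x :: "'a::linordered_semidom"
  assumes "x \<ge> 0"
  shows "x ^ n \<le> pochhammer x n"
proof (induction n)
  case (Suc n)
  have "x ^ n * x \<le> pochhammer x n * (x + of_nat n)"
    using Suc assms order_trans[OF zero_le_power Suc] by (intro mult_mono) auto
  then show ?case
    by (simp add: pochhammer_Suc mult.commute)
qed simp

definition bessel_coeff :: "real \<Rightarrow> real \<Rightarrow> nat \<Rightarrow> complex" where
  "bessel_coeff \<kappa> c n = (- of_real c / 4) ^ n / (pochhammer (of_real \<kappa>) n * fact n)"

lemma norm_bessel_coeff_le:
  assumes "c \<le> 0" and "\<kappa> > 0"
  shows "norm (bessel_coeff \<kappa> c n) \<le> (- c / (4 * \<kappa>)) ^ n / fact n"
proof -
  have pos: "0 < \<kappa> ^ n" "0 < pochhammer \<kappa> n" and le: "\<kappa> ^ n \<le> pochhammer \<kappa> n"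
    using assms power_le_pochhammer[of \<kappa> n] by (auto simp: pochhammer_pos)
  have "bessel_coeff \<kappa> c n = of_real ((- c / 4) ^ n / (pochhammer \<kappa> n * fact n))"
    by (simp add: bessel_coeff_def pochhammer_of_real)
  moreover have "0 \<le> (- c / 4) ^ n / (pochhammer \<kappa> n * fact n)"
    using assms pos by (intro divide_nonneg_nonneg zero_le_power mult_nonneg_nonneg) auto
  ultimately have "norm (bessel_coeff \<kappa> c n) = (- c / 4) ^ n / (pochhammer \<kappa> n * fact n)"
    by (metis abs_of_nonneg norm_of_real)
  also have "\<dots> \<le> (- c / 4) ^ n / (\<kappa> ^ n * fact n)"
    using assms pos le by (intro divide_left_mono mult_right_mono mult_pos_pos) auto
  also have "\<dots> = (- c / (4 * \<kappa>)) ^ n / fact n"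
    by (simp only: power_divide power_mult_distrib divide_divide_eq_left mult.assoc)
  finally show ?thesis .
qed

text \<open>Termwise domination by the exponential series, applied below both to \<open>u\<close> and, after
  differentiating the series, to \<open>u'\<close>; the factor \<open>C\<close> absorbs the \<open>t\<close> that differentiation
  produces.\<close>

lemma exp_dominated_power_series:
  fixes a :: "nat \<Rightarrow> complex"
  assumes "\<And>n. norm (a n) \<le> C * (t ^ n / fact n)"
  shows "summable (\<lambda>n. a n * z ^ n)"
    and "norm (\<Sum>n. a n * z ^ n) \<le> C * exp (t * norm z)"
proof -
  have majorant: "(\<lambda>n. C * ((t * norm z) ^ n / fact n)) sums (C * exp (t * norm z))"
    using sums_mult[OF exp_converges[of "t * norm z"], of C] by (simp add: divide_inverse_commute)
  have bound: "norm (a n * z ^ n) \<le> C * ((t * norm z) ^ n / fact n)" for n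
    using mult_right_mono[OF assms[of n], of "norm z ^ n"]
    by (simp add: norm_mult norm_power power_mult_distrib)
  show "summable (\<lambda>n. a n * z ^ n)"
    by (rule summable_comparison_test'[OF sums_summable[OF majorant]]) (rule bound)
  show "norm (\<Sum>n. a n * z ^ n) \<le> C * exp (t * norm z)"
    by (rule norm_suminf_le[OF bound sums_summable[OF majorant],
          unfolded sums_unique[OF majorant, symmetric]])
qed

lemma norm_power_series_minus_1_le:
  fixes a :: "nat \<Rightarrow> complex"
  assumes bound: "\<And>n. norm (a n) \<le> t ^ n / fact n" and "a 0 = 1"
  shows "norm ((\<Sum>n. a n * z ^ n) - 1) \<le> exp (t * norm z) - 1"
proof -
  have "(\<lambda>n. a n * z ^ n) sums (\<Sum>n. a n * z ^ n)"
    using exp_dominated_power_series(1)[of a 1 t z] bound by (simp add: summable_sums)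
  then have tail: "(\<lambda>n. a (Suc n) * z ^ Suc n) sums ((\<Sum>n. a n * z ^ n) - 1)"
    using sums_Suc_iff[of "\<lambda>n. a n * z ^ n"] assms(2) by simp
  have "(\<lambda>n. (t * norm z) ^ n / fact n) sums exp (t * norm z)"
    using exp_converges[of "t * norm z"] by (simp add: divide_inverse_commute)
  then have majorant: "(\<lambda>n. (t * norm z) ^ Suc n / fact (Suc n)) sums (exp (t * norm z) - 1)"
    using sums_Suc_iff[of "\<lambda>n. (t * norm z) ^ n / fact n"] by simp
  have "norm (a (Suc n) * z ^ Suc n) \<le> (t * norm z) ^ Suc n / fact (Suc n)" for n
    using mult_right_mono[OF bound[of "Suc n"], of "norm z ^ Suc n"]
    unfolding norm_mult norm_power power_mult_distrib by (simp del: power_Suc fact_Suc)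
  from norm_suminf_le[OF this sums_summable[OF majorant]] show ?thesis
    by (simp only: sums_unique[OF tail, symmetric] sums_unique[OF majorant, symmetric])
qed

lemma exp_dominated_power_series_derivative:
  fixes a :: "nat \<Rightarrow> complex"
  assumes bound: "\<And>n. norm (a n) \<le> t ^ n / fact n"
  obtains D where "((\<lambda>z. \<Sum>n. a n * z ^ n) has_field_derivative D) (at z)"
    and "norm D \<le> t * exp (t * norm z)"
proof
  show "((\<lambda>z. \<Sum>n. a n * z ^ n) has_field_derivative (\<Sum>n. diffs a n * z ^ n)) (at z)"
    using exp_dominated_power_series(1)[of a 1 t] bound
    by (intro termdiffs_strong_converges_everywhere) simp
  have "norm (diffs a n) \<le> t * (t ^ n / fact n)" for n
    using mult_left_mono[OF bound[of "Suc n"], of "real (Suc n)"]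
    by (simp add: diffs_def norm_mult field_simps del: of_nat_Suc)
  then show "norm (\<Sum>n. diffs a n * z ^ n) \<le> t * exp (t * norm z)"
    by (rule exp_dominated_power_series(2))
qed

text \<open>Normalising a power series with constant term \<open>1\<close> by the factor \<open>z\<close> lands in the class of
  normalised analytic functions: coefficients are shifted by one place.\<close>

lemma class_A_times_power_series:
  fixes a :: "nat \<Rightarrow> complex"
  assumes "a 0 = 1" and summable: "\<And>z. summable (\<lambda>n. a n * z ^ n)"
  shows "(\<lambda>z. z * (\<Sum>n. a n * z ^ n)) \<in> class_A"
proof -
  have "((\<lambda>z. \<Sum>n. a n * z ^ n) has_field_derivative (\<Sum>n. diffs a n * z ^ n)) (at z)" for z
    by (rule termdiffs_strong_converges_everywhere[OF summable])
  then have "(\<lambda>z. \<Sum>n. a n * z ^ n) holomorphic_on unit_disc"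
    using holomorphic_on_open[OF open_ball] by blast
  then have "(\<lambda>z. z * (\<Sum>n. a n * z ^ n)) analytic_on unit_disc"
    by (intro analytic_intros) (simp add: analytic_on_open)
  moreover have "(\<lambda>n. a (n + 2 - 1) * z ^ (n + 2)) sums (z * (\<Sum>n. a n * z ^ n) - z)" for z
  proof -
    have "(\<lambda>n. a (Suc n) * z ^ Suc n) sums ((\<Sum>n. a n * z ^ n) - 1)"
      using summable_sums[OF summable[of z]] sums_Suc_iff[of "\<lambda>n. a n * z ^ n"] assms(1) by simp
    from sums_mult[OF this, of z] show ?thesis
      by (simp add: algebra_simps)
  qed
  then have "\<exists>b :: nat \<Rightarrow> complex. \<forall>z\<in>unit_disc.
      (\<lambda>n. b (n + 2) * z ^ (n + 2)) sums (z * (\<Sum>n. a n * z ^ n) - z)"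
    by (intro exI[of _ "\<lambda>n. a (n - 1)"]) blast
  ultimately show ?thesis
    by (simp add: class_A_def)
qed

text \<open>The rotated quotient \<open>exp (- \<i> * \<alpha>) * q\<close> lies within \<open>cmod (q - 1)\<close> of
  \<open>exp (- \<i> * \<alpha>)\<close>, whose real part is \<open>cos \<alpha>\<close>; the other \<open>cmod (q - 1)\<close> is the one in the
  defining inequality.\<close>

lemma spirallike_inequalityI:
  assumes "2 * cmod (q - 1) < cos \<alpha> - \<beta>"
  shows "Re (exp (- \<i> * of_real \<alpha>) * q) > cmod (q - 1) + \<beta>"
proof -
  have "- Re (exp (- \<i> * of_real \<alpha>) * (q - 1)) \<le> cmod (exp (- \<i> * of_real \<alpha>) * (q - 1))"
    using abs_Re_le_cmod[of "exp (- \<i> * of_real \<alpha>) * (q - 1)"] by linarith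
  also have "\<dots> = cmod (q - 1)"
    by (simp add: norm_mult)
  finally have "- Re (exp (- \<i> * of_real \<alpha>) * (q - 1)) \<le> cmod (q - 1)" .
  moreover have "Re (exp (- \<i> * of_real \<alpha>) * q) =
      cos \<alpha> + Re (exp (- \<i> * of_real \<alpha>) * (q - 1))"
    by (simp add: Re_exp Im_exp algebra_simps)
  ultimately show ?thesis
    using assms by linarith
qed

text \<open>The estimate \<open>1 - cmod (u z - 1) \<le> cmod (u z)\<close> turns the bound on \<open>u - 1\<close> into a lower
  bound for the denominator of \<open>q - 1 = z * u' z / u z\<close>; in particular \<open>u\<close> has no zero in the
  disc.\<close>

lemma log_deriv_quotient_times_bound:
  assumes deriv: "(u has_field_derivative D) (at z)"
    and u: "cmod (u z - 1) \<le> exp (t * cmod z) - 1"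
    and D: "cmod D \<le> t * exp (t * cmod z)"
    and z: "cmod z < 1" and "t > 0" and "d > 0"
    and cond: "2 * t * exp t \<le> d * (2 - exp t)"
  shows "2 * cmod (log_deriv_quotient (\<lambda>w. w * u w) z - 1) < d"
proof (cases "z = 0")
  case True
  then show ?thesis
    using \<open>d > 0\<close> by (simp add: log_deriv_quotient_def)
next
  case False
  define s where "s = t * cmod z"
  have "0 \<le> s" and "s < t"
    using z \<open>t > 0\<close> by (simp_all add: s_def)
  then have "exp s < exp t"
    by simp
  have "s * exp s < t * exp t"
    using \<open>0 \<le> s\<close> \<open>s < t\<close> \<open>exp s < exp t\<close> by (intro mult_strict_mono') auto
  moreover have "d * (2 - exp t) \<le> d * (2 - exp s)"
    using \<open>exp s < exp t\<close> \<open>d > 0\<close> by (intro mult_left_mono) auto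
  ultimately have strict: "2 * (s * exp s) < d * (2 - exp s)"
    using cond by linarith
  have lower: "2 - exp s \<le> cmod (u z)"
    using u norm_triangle_ineq2[of 1 "1 - u z"] by (simp add: s_def norm_minus_commute)
  have "0 < d * (2 - exp s)"
    using strict \<open>0 \<le> s\<close> by (smt (verit) exp_ge_zero mult_nonneg_nonneg)
  then have "0 < 2 - exp s"
    using \<open>d > 0\<close> by (simp add: zero_less_mult_iff)
  with lower have "u z \<noteq> 0"
    by auto
  have "((\<lambda>w. w * u w) has_field_derivative (u z + z * D)) (at z)"
    by (rule derivative_eq_intros deriv refl)+ simp
  then have "log_deriv_quotient (\<lambda>w. w * u w) z - 1 = z * D / u z"
    using False \<open>u z \<noteq> 0\<close> by (simp add: log_deriv_quotient_def DERIV_imp_deriv field_simps)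
  then have quotient: "cmod (log_deriv_quotient (\<lambda>w. w * u w) z - 1) * cmod (u z) = cmod z * cmod D"
    using \<open>u z \<noteq> 0\<close> by (simp add: norm_mult norm_divide)
  have "cmod z * cmod D \<le> s * exp s"
    using mult_left_mono[OF D, of "cmod z"] by (simp add: s_def algebra_simps)
  moreover have "2 * (s * exp s) < d * cmod (u z)"
    using strict mult_left_mono[OF lower, of d] \<open>d > 0\<close> by linarith
  ultimately have "2 * cmod (log_deriv_quotient (\<lambda>w. w * u w) z - 1) * cmod (u z) < d * cmod (u z)"
    using quotient by (simp add: mult.assoc)
  then show ?thesis
    using \<open>u z \<noteq> 0\<close> by simp
qed

theorem theorem2p3:
  fixes \<alpha> \<beta> c \<kappa> :: real and p b :: complex
  assumes "\<bar>\<alpha>\<bar> < pi / 2" and "0 \<le> \<beta>" and "\<beta> < 1"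
    and "bessel_kappa p b = of_real \<kappa>"
    and "c < 0" and "\<kappa> > 0"
    and "exp (- c / (4 * \<kappa>)) *
           (- c / (2 * \<kappa>) + (2 - cos \<alpha> - \<beta>) * (1 - exp (c / (4 * \<kappa>))))
         \<le> cos \<alpha> - \<beta>"
  shows "(\<lambda>z. z * bessel_u p b (of_real c) z) \<in> class_SP \<alpha> \<beta>"
proof -
  define a where "a = bessel_coeff \<kappa> c"
  define t where "t = - c / (4 * \<kappa>)"
  define d where "d = cos \<alpha> - \<beta>"
  have "t > 0"
    using assms(5,6) by (simp add: t_def divide_neg_pos)
  have a0: "a 0 = 1"
    by (simp add: a_def bessel_coeff_def)
  have bound: "norm (a n) \<le> t ^ n / fact n" for n
    unfolding a_def t_def using assms(5,6) by (intro norm_bessel_coeff_le) auto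
  have bessel: "bessel_u p b (of_real c) = (\<lambda>z. \<Sum>n. a n * z ^ n)"
    by (simp add: fun_eq_iff bessel_u_def a_def bessel_coeff_def assms(4))

  have "- c / (2 * \<kappa>) = 2 * t" and "c / (4 * \<kappa>) = - t"
    by (simp_all add: t_def)
  then have "exp t * (2 * t + (2 - cos \<alpha> - \<beta>) * (1 - exp (- t))) \<le> d"
    using assms(7) unfolding d_def by (simp only: t_def[symmetric])
  moreover have "exp t * (2 * t + (2 - cos \<alpha> - \<beta>) * (1 - exp (- t)))
      = 2 * t * exp t + (2 - cos \<alpha> - \<beta>) * (exp t - 1)"
    by (simp add: exp_minus field_simps)
  ultimately have hyp: "2 * t * exp t + (2 - cos \<alpha> - \<beta>) * (exp t - 1) \<le> d"
    by simp
  have "exp t - 1 > 0"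
    using \<open>t > 0\<close> by simp
  have "d \<le> 2 - cos \<alpha> - \<beta>" and "0 \<le> 2 - cos \<alpha> - \<beta>"
    using cos_le_one[of \<alpha>] assms(3) unfolding d_def by linarith+
  then have "d * (exp t - 1) \<le> (2 - cos \<alpha> - \<beta>) * (exp t - 1)"
    and "0 \<le> (2 - cos \<alpha> - \<beta>) * (exp t - 1)"
    using \<open>exp t - 1 > 0\<close> by (auto intro: mult_right_mono)
  moreover have "0 < 2 * t * exp t"
    using \<open>t > 0\<close> by simp
  ultimately have "d > 0" and cond: "2 * t * exp t \<le> d * (2 - exp t)"
    using hyp by (auto simp: algebra_simps)

  have "(\<lambda>z. z * (\<Sum>n. a n * z ^ n)) \<in> class_A"
    using a0 exp_dominated_power_series(1)[of a 1 t] bound by (intro class_A_times_power_series) auto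
  moreover have "Re (exp (- \<i> * of_real \<alpha>) * log_deriv_quotient (\<lambda>z. z * (\<Sum>n. a n * z ^ n)) z)
      > cmod (log_deriv_quotient (\<lambda>z. z * (\<Sum>n. a n * z ^ n)) z - 1) + \<beta>"
    if "z \<in> unit_disc" for z
  proof (rule spirallike_inequalityI)
    obtain D where "((\<lambda>z. \<Sum>n. a n * z ^ n) has_field_derivative D) (at z)"
      and "norm D \<le> t * exp (t * norm z)"
      using exp_dominated_power_series_derivative[OF bound] by blast
    then show "2 * cmod (log_deriv_quotient (\<lambda>z. z * (\<Sum>n. a n * z ^ n)) z - 1) < cos \<alpha> - \<beta>"
      using that \<open>t > 0\<close> \<open>d > 0\<close> cond norm_power_series_minus_1_le[OF bound a0]
      unfolding d_def[symmetric] by (intro log_deriv_quotient_times_bound) auto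
  qed
  ultimately show ?thesis
    unfolding class_SP_def bessel by blast
qed

end
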